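(* Let $m\ge 1$. Every linear fractional map $\varphi:\mathbb{B}^m\to\mathbb{B}^m$ belongs to the Schur-Agler class $\mathcal{S}_m$.
   Context: $\mathbb{B}^m$ denotes the open unit ball of $\mathbb{C}^m$, and $\langle\cdot,\cdot\rangle$ the standard Hermitian inner product on $\mathbb{C}^m$ (linear in the first argument). A linear fractional map on $\mathbb{B}^m$ is a function of the form $\varphi(z)=\dfrac{Az+B}{\langle z,C\rangle+D}$, where $A$ is an $m\times m$ complex matrix, $B,C$ are column vectors in $\mathbb{C}^m$ and $D\in\mathbb{C}$ (with denominator nonvanishing on $\mathbb{B}^m$). The Schur-Agler class $\mathcal{S}_m$ is the set of all holomorphic maps $\varphi:\mathbb{B}^m\to\mathbb{B}^m$ for which the Hermitian kernel $$k^\varphi(z,w)=\frac{1-\langle\varphi(z),\varphi(w)\rangle}{1-\langle z,w\rangle}$$ on $\mathbb{B}^m\times\mathbb{B}^m$ is positive semidefinite, i.e. for all finite sets of points $z_1,\dots,z_N\in\mathbb{B}^m$ the matrix $(k^\varphi(z_i,z_j))_{i,j}$ is positive semidefinite. *)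

theory Defs
  imports "HOL-Analysis.Analysis"
begin

definition hinner :: "complex ^ 'm \<Rightarrow> complex ^ 'm \<Rightarrow> complex" where
  "hinner z w = (\<Sum>i\<in>UNIV. z $ i * cnj (w $ i))"

text \<open>The Hermitian norm is the library norm, so the open unit ball of \<open>\<complex>\<^sup>m\<close> is \<open>ball 0 1\<close>.\<close>

lemma hinner_self: "hinner z z = of_real ((norm z)\<^sup>2)"
  by (simp add: hinner_def norm_vec_def L2_set_def real_sqrt_pow2 sum_nonneg
      complex_norm_square[unfolded of_real_power])

abbreviation unit_ball :: "(complex ^ 'm) set" where
  "unit_ball \<equiv> ball 0 1"

text \<open>Holomorphy in several variables on a set intended to be open: Frechet differentiability with
  a \<open>\<complex>\<close>-linear derivative, i.e. one given by a complex matrix.\<close>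

definition holomorphic_map_on :: "(complex ^ 'm \<Rightarrow> complex ^ 'n) \<Rightarrow> (complex ^ 'm) set \<Rightarrow> bool" where
  "holomorphic_map_on f S \<longleftrightarrow>
     (\<forall>z\<in>S. \<exists>J :: complex ^ 'm ^ 'n. (f has_derivative (\<lambda>h. J *v h)) (at z within S))"

text \<open>Only the values of \<open>\<phi>\<close> on the ball matter. \<open>*s\<close> is multiplication of a vector by a complex
  scalar.\<close>

definition linear_fractional :: "(complex ^ 'm \<Rightarrow> complex ^ 'm) \<Rightarrow> bool" where
  "linear_fractional \<phi> \<longleftrightarrow>
     (\<exists>(A :: complex ^ 'm ^ 'm) (B :: complex ^ 'm) (C :: complex ^ 'm) (D :: complex).
        \<forall>z\<in>unit_ball. hinner z C + D \<noteq> 0 \<and>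
          \<phi> z = (1 / (hinner z C + D)) *s (A *v z + B))"

text \<open>An \<open>N \<times> N\<close> matrix is a function of two indices below \<open>N\<close>, since \<open>N\<close> is quantified over
  in the definition of a positive semidefinite kernel.\<close>

definition psd_matrix :: "nat \<Rightarrow> (nat \<Rightarrow> nat \<Rightarrow> complex) \<Rightarrow> bool" where
  "psd_matrix N M \<longleftrightarrow>
     (\<forall>i<N. \<forall>j<N. M j i = cnj (M i j)) \<and>
     (\<forall>c :: nat \<Rightarrow> complex. (\<Sum>i<N. \<Sum>j<N. cnj (c i) * M i j * c j) \<in> \<real>\<^sub>\<ge>\<^sub>0)"

definition psd_kernel_on :: "'a set \<Rightarrow> ('a \<Rightarrow> 'a \<Rightarrow> complex) \<Rightarrow> bool" where
  "psd_kernel_on X k \<longleftrightarrow>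
     (\<forall>(N :: nat) (z :: nat \<Rightarrow> 'a). (\<forall>i<N. z i \<in> X) \<longrightarrow> psd_matrix N (\<lambda>i j. k (z i) (z j)))"

definition schur_kernel ::
  "(complex ^ 'm \<Rightarrow> complex ^ 'm) \<Rightarrow> complex ^ 'm \<Rightarrow> complex ^ 'm \<Rightarrow> complex" where
  "schur_kernel \<phi> z w = (1 - hinner (\<phi> z) (\<phi> w)) / (1 - hinner z w)"

definition schur_agler_class :: "(complex ^ 'm \<Rightarrow> complex ^ 'm) set" where
  "schur_agler_class =
     {\<phi>. holomorphic_map_on \<phi> unit_ball \<and> \<phi> ` unit_ball \<subseteq> unit_ball \<and>
          psd_kernel_on unit_ball (schur_kernel \<phi>)}"

end

theory Submission
  imports Defs
begin

text \<open>
  Write \<open>\<phi> = n / d\<close> with \<open>n z = A *v z + B\<close> and \<open>d z = hinner z C + D\<close>, and homogenize: a point \<open>z\<close>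
  becomes a pair \<open>(z, t)\<close> in \<open>\<complex>\<^sup>m \<times> \<complex>\<close>, with numerator \<open>A *v z + t *s B\<close> and denominator
  \<open>hinner z C + t * D\<close>. That \<open>\<phi>\<close> maps the ball into itself implies that the Hermitian form
  \<open>F = \<bar>denominator\<bar>\<^sup>2 - \<parallel>numerator\<parallel>\<^sup>2\<close> is nonnegative wherever the indefinite form
  \<open>G = \<bar>t\<bar>\<^sup>2 - \<parallel>z\<parallel>\<^sup>2\<close> is (\<open>homogenized_denominator_dominates\<close>). Such an implication between the
  signs of two quadratic forms has a linear certificate once \<open>G\<close> is positive somewhere, here at
  \<open>(0, 1)\<close>: by the S-lemma there is \<open>\<kappa> \<ge> 0\<close> such that
  \<open>F - \<kappa> G\<close> is nonnegative everywhere (\<open>s_lemma\<close>, \<open>s_lemma_linear_fractional\<close>).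

  Let \<open>H\<close> be the polarization of \<open>F - \<kappa> G\<close>, evaluated at \<open>(z, 1)\<close> and \<open>(w, 1)\<close>. It is a positive
  semidefinite kernel, and
  \<open>d z * cnj (d w) * (1 - hinner (\<phi> z) (\<phi> w)) = \<kappa> * (1 - hinner z w) + H z w\<close>. Hence the Schur kernel is
  \<open>(\<kappa> + H z w / (1 - hinner z w)) / (d z * cnj (d w))\<close>.
  Positivity is preserved when \<open>H\<close> is multiplied by the kernel \<open>1 / (1 - hinner z w)\<close>
  (\<open>psd_matrix_divide_one_minus_hinner\<close>), when the constant \<open>\<kappa>\<close> is added, and under the congruence by
  \<open>1 / d\<close> (\<open>psd_matrix_congruence\<close>).
\<close>

section \<open>The S-lemma\<close>

text \<open>
  The admissible multipliers \<open>\<kappa>\<close> are those between \<open>F v v / G v v\<close> for \<open>G v v < 0\<close> and \<open>F u u / G u u\<close>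
  for \<open>G u u > 0\<close>, so only the separation of these two families of quotients is at stake. If it
  failed, some \<open>P = F - \<mu> G\<close> would be negative at both \<open>u\<close> and \<open>v\<close>. After a change of the sign of
  \<open>v\<close> it is then negative on the whole segment from \<open>u\<close> to \<open>v\<close>, which crosses a zero of
  \<open>G\<close>; there \<open>F = P < 0\<close>, against the hypothesis.
\<close>
lemma s_lemma:
  fixes F G :: "'a::real_vector \<Rightarrow> 'a \<Rightarrow> real"
  assumes F: "bilinear F" and symF: "\<And>x y. F x y = F y x"
    and G: "bilinear G" and symG: "\<And>x y. G x y = G y x"
    and imp: "\<And>x. G x x \<ge> 0 \<Longrightarrow> F x x \<ge> 0"
    and pos: "G e e > 0"
  obtains \<kappa> where "\<kappa> \<ge> 0" "\<And>x. F x x \<ge> \<kappa> * G x x"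
proof -
  have separated: "F v v / G v v \<le> F u u / G u u" if u: "G u u > 0" and v: "G v v < 0" for u v
  proof (rule ccontr)
    assume "\<not> ?thesis"
    then obtain \<mu> where \<mu>: "F u u / G u u < \<mu>" "\<mu> < F v v / G v v"
      using dense by (meson not_le)
    define P where "P x y = F x y - \<mu> * G x y" for x y
    have Pu: "P u u < 0" using \<mu>(1) u by (simp add: P_def field_simps)
    have Pv: "P v v < 0" using \<mu>(2) v by (simp add: P_def field_simps)
    \<comment> \<open>The cross term of \<open>P\<close> changes sign with \<open>v\<close>; the choice makes it help rather than hurt.\<close>
    define w where "w = (if P u v \<le> 0 then v else - v)"
    have Pw: "P w w < 0" and Gw: "G w w < 0" and Puw: "P u w \<le> 0"
      using Pv v by (auto simp: w_def P_def bilinear_lneg[OF F] bilinear_rneg[OF F]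
          bilinear_lneg[OF G] bilinear_rneg[OF G])
    define p where "p s = (1 - s) *\<^sub>R u + s *\<^sub>R w" for s
    have expand: "Q (p s) (p s) = (1 - s)\<^sup>2 * Q u u + 2 * s * (1 - s) * Q u w + s\<^sup>2 * Q w w"
      if "bilinear Q" "\<And>x y. Q x y = Q y x" for Q :: "'a \<Rightarrow> 'a \<Rightarrow> real" and s
      unfolding p_def bilinear_ladd[OF that(1)] bilinear_radd[OF that(1)]
        bilinear_lmul[OF that(1)] bilinear_rmul[OF that(1)] that(2)[of w u]
      by (simp add: power2_eq_square algebra_simps)
    have "\<exists>s\<ge>0. s \<le> 1 \<and> G (p s) (p s) = 0"
    proof (rule IVT2')
      show "G (p 1) (p 1) \<le> 0" "0 \<le> G (p 0) (p 0)"
        using u Gw by (simp_all add: p_def)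
      show "continuous_on {0..1} (\<lambda>s. G (p s) (p s))"
        unfolding expand[OF G symG] by (intro continuous_intros)
    qed simp
    then obtain s where s: "0 \<le> s" "s \<le> 1" "G (p s) (p s) = 0" by blast
    have "F (p s) (p s) = P (p s) (p s)"
      by (simp add: P_def s(3))
    also have "\<dots> = (1 - s)\<^sup>2 * P u u + 2 * s * (1 - s) * P u w + s\<^sup>2 * P w w"
      unfolding P_def expand[OF F symF] expand[OF G symG] by (simp add: algebra_simps)
    also have "\<dots> < 0"
    proof -
      have "2 * s * (1 - s) * P u w \<le> 0"
        using s Puw by (intro mult_nonneg_nonpos) auto
      moreover have "(1 - s)\<^sup>2 * P u u + s\<^sup>2 * P w w < 0"
      proof (cases "s = 0")
        case False
        then have "s\<^sup>2 * P w w < 0" using Pw by (simp add: mult_pos_neg)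
        moreover have "(1 - s)\<^sup>2 * P u u \<le> 0" using Pu by (simp add: mult_nonneg_nonpos)
        ultimately show ?thesis by linarith
      qed (use Pu in simp)
      ultimately show ?thesis by linarith
    qed
    finally show False using imp[of "p s"] s(3) by simp
  qed
  define S where "S = {F u u / G u u | u. G u u > 0}"
  have S: "F e e / G e e \<in> S" using pos by (auto simp: S_def)
  have S0: "0 \<le> r" if "r \<in> S" for r using that imp by (auto simp: S_def)
  show thesis
  proof
    show "Inf S \<ge> 0" using S S0 by (intro cInf_greatest) auto
    fix x
    consider "G x x > 0" | "G x x = 0" | "G x x < 0" by linarith
    then show "F x x \<ge> Inf S * G x x"
    proof cases
      case 1
      then have "Inf S \<le> F x x / G x x"
        using S0 by (intro cInf_lower bdd_belowI[of _ 0]) (auto simp: S_def)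
      with 1 show ?thesis by (simp add: field_simps)
    next
      case 2
      then show ?thesis using imp[of x] by simp
    next
      case 3
      then have "F x x / G x x \<le> Inf S"
        using S separated by (intro cInf_greatest) (auto simp: S_def)
      with 3 show ?thesis by (simp add: field_simps)
    qed
  qed
qed

section \<open>Positive semidefinite matrices\<close>

lemma psd_matrixI:
  assumes "\<And>i j. i < N \<Longrightarrow> j < N \<Longrightarrow> M j i = cnj (M i j)"
    and "\<And>c. (\<Sum>i<N. \<Sum>j<N. cnj (c i) * M i j * c j) \<in> \<real>\<^sub>\<ge>\<^sub>0"
  shows "psd_matrix N M"
  using assms unfolding psd_matrix_def by blast

lemma psd_matrix_hermitian: "psd_matrix N M \<Longrightarrow> i < N \<Longrightarrow> j < N \<Longrightarrow> M j i = cnj (M i j)"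
  unfolding psd_matrix_def by blast

lemma psd_matrix_form:
  "psd_matrix N M \<Longrightarrow> (\<Sum>i<N. \<Sum>j<N. cnj (c i) * M i j * c j) \<in> \<real>\<^sub>\<ge>\<^sub>0"
  unfolding psd_matrix_def by blast

lemma psd_matrix_cong:
  assumes "\<And>i j. i < N \<Longrightarrow> j < N \<Longrightarrow> M i j = M' i j"
  shows "psd_matrix N M = psd_matrix N M'"
  using assms unfolding psd_matrix_def by simp

lemma psd_matrix_add:
  assumes "psd_matrix N M" "psd_matrix N M'"
  shows "psd_matrix N (\<lambda>i j. M i j + M' i j)"
proof (rule psd_matrixI)
  fix c :: "nat \<Rightarrow> complex"
  have "(\<Sum>i<N. \<Sum>j<N. cnj (c i) * (M i j + M' i j) * c j) =
     (\<Sum>i<N. \<Sum>j<N. cnj (c i) * M i j * c j) + (\<Sum>i<N. \<Sum>j<N. cnj (c i) * M' i j * c j)"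
    by (simp add: algebra_simps sum.distrib)
  then show "(\<Sum>i<N. \<Sum>j<N. cnj (c i) * (M i j + M' i j) * c j) \<in> \<real>\<^sub>\<ge>\<^sub>0"
    using assms psd_matrix_form by (simp add: nonneg_Reals_add_I)
next
  fix i j assume "i < N" "j < N"
  then show "M j i + M' j i = cnj (M i j + M' i j)"
    using assms[THEN psd_matrix_hermitian, of i j] by simp
qed

lemma psd_matrix_sum:
  assumes "\<And>k. k \<in> K \<Longrightarrow> psd_matrix N (M k)"
  shows "psd_matrix N (\<lambda>i j. \<Sum>k\<in>K. M k i j)"
  using assms
proof (induction K rule: infinite_finite_induct)
  case (insert k K)
  then show ?case by (simp add: psd_matrix_add)
qed (simp_all add: psd_matrix_def)

lemma psd_matrix_congruence:
  assumes "psd_matrix N M"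
  shows "psd_matrix N (\<lambda>i j. a i * M i j * cnj (a j))"
proof (rule psd_matrixI)
  fix c :: "nat \<Rightarrow> complex"
  show "(\<Sum>i<N. \<Sum>j<N. cnj (c i) * (a i * M i j * cnj (a j)) * c j) \<in> \<real>\<^sub>\<ge>\<^sub>0"
    using psd_matrix_form[OF assms, of "\<lambda>i. cnj (a i) * c i"] by (simp add: mult_ac)
next
  fix i j assume "i < N" "j < N"
  then show "a j * M j i * cnj (a i) = cnj (a i * M i j * cnj (a j))"
    using psd_matrix_hermitian[OF assms, of i j] by (simp add: mult_ac)
qed

lemma psd_matrix_limit:
  assumes "\<And>n. psd_matrix N (M n)"
    and lim: "\<And>i j. i < N \<Longrightarrow> j < N \<Longrightarrow> (\<lambda>n. M n i j) \<longlonglongrightarrow> L i j"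
  shows "psd_matrix N L"
proof (rule psd_matrixI)
  fix i j assume ij: "i < N" "j < N"
  have "(\<lambda>n. M n j i) \<longlonglongrightarrow> cnj (L i j)"
    using tendsto_cnj[OF lim[OF ij]] psd_matrix_hermitian[OF assms(1) ij] by simp
  then show "L j i = cnj (L i j)" using LIMSEQ_unique lim ij by blast
next
  fix c :: "nat \<Rightarrow> complex"
  have "(\<lambda>n. \<Sum>i<N. \<Sum>j<N. cnj (c i) * M n i j * c j) \<longlonglongrightarrow> (\<Sum>i<N. \<Sum>j<N. cnj (c i) * L i j * c j)"
    using lim by (intro tendsto_intros) auto
  then show "(\<Sum>i<N. \<Sum>j<N. cnj (c i) * L i j * c j) \<in> \<real>\<^sub>\<ge>\<^sub>0"
    by (rule closed_sequentially[OF closed_nonneg_Reals_complex psd_matrix_form[OF assms(1)]])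
qed

lemma rank_one_form:
  fixes a c :: "nat \<Rightarrow> complex"
  shows "(\<Sum>i<N. \<Sum>j<N. cnj (c i) * (a i * cnj (a j)) * c j) =
     of_real ((norm (\<Sum>i<N. cnj (c i) * a i))\<^sup>2)"
proof -
  have "of_real ((norm (\<Sum>i<N. cnj (c i) * a i))\<^sup>2) =
      (\<Sum>i<N. cnj (c i) * a i) * cnj (\<Sum>i<N. cnj (c i) * a i)"
    by (simp add: complex_norm_square[unfolded of_real_power])
  then show ?thesis by (simp add: sum_product mult_ac)
qed

lemma psd_matrix_const:
  assumes "\<kappa> \<ge> 0"
  shows "psd_matrix N (\<lambda>i j. complex_of_real \<kappa>)"
proof (rule psd_matrixI)
  fix c :: "nat \<Rightarrow> complex"
  have "(\<Sum>i<N. \<Sum>j<N. cnj (c i) * complex_of_real \<kappa> * c j) =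
      of_real \<kappa> * (\<Sum>i<N. \<Sum>j<N. cnj (c i) * (1 * cnj 1) * c j)"
    by (simp add: sum_distrib_left mult_ac)
  also have "\<dots> = of_real (\<kappa> * (norm (\<Sum>i<N. cnj (c i) * 1))\<^sup>2)"
    unfolding rank_one_form by simp
  finally show "(\<Sum>i<N. \<Sum>j<N. cnj (c i) * complex_of_real \<kappa> * c j) \<in> \<real>\<^sub>\<ge>\<^sub>0"
    using assms by (simp only: nonneg_Reals_of_real_iff) simp
qed simp

section \<open>The kernel \<open>1 / (1 - hinner z w)\<close> of the ball\<close>

lemma cnj_hinner: "cnj (hinner z w) = hinner w z"
  by (simp add: hinner_def mult_ac)

lemma norm_hinner_le: "norm (hinner z w) \<le> norm z * norm w"
proof -
  have "norm (hinner z w) \<le> (\<Sum>i\<in>UNIV. norm (z $ i) * norm (w $ i))"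
    unfolding hinner_def by (rule order_trans[OF norm_sum]) (simp add: norm_mult)
  also have "\<dots> \<le> norm z * norm w"
    unfolding norm_vec_def using L2_set_mult_ineq[of "\<lambda>i. norm (z $ i)" "\<lambda>i. norm (w $ i)" UNIV]
    by simp
  finally show ?thesis .
qed

lemma norm_hinner_less_one:
  assumes "z \<in> unit_ball" "w \<in> unit_ball"
  shows "norm (hinner z w) < 1"
proof -
  have "norm z * norm w < 1 * 1"
    using assms by (intro mult_strict_mono') auto
  then show ?thesis using norm_hinner_le[of z w] by simp
qed

text \<open>
  The case of the Schur product theorem that is needed: \<open>hinner\<close> is a sum over the coordinates of
  rank-one kernels, and the entrywise product with a rank-one kernel is a congruence.
\<close>
lemma psd_matrix_mult_hinner:
  assumes "psd_matrix N M"
  shows "psd_matrix N (\<lambda>i j. M i j * hinner (z i) (z j))"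
proof -
  have "psd_matrix N (\<lambda>i j. \<Sum>k\<in>UNIV. z i $ k * M i j * cnj (z j $ k))"
    by (intro psd_matrix_sum psd_matrix_congruence assms)
  then show ?thesis by (simp add: hinner_def sum_distrib_left mult_ac)
qed

text \<open>
  Expand \<open>1 / (1 - hinner z w)\<close> into a geometric series, which converges on the ball by
  Cauchy-Schwarz. Its partial sums are handled by \<open>psd_matrix_mult_hinner\<close>, applied once for each
  power.
\<close>
lemma psd_matrix_divide_one_minus_hinner:
  assumes "psd_matrix N M" and z: "\<And>i. i < N \<Longrightarrow> z i \<in> unit_ball"
  shows "psd_matrix N (\<lambda>i j. M i j / (1 - hinner (z i) (z j)))"
proof (rule psd_matrix_limit)
  have "psd_matrix N (\<lambda>i j. M i j * hinner (z i) (z j) ^ k)" for k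
  proof (induction k)
    case (Suc k)
    from psd_matrix_mult_hinner[OF this, of z] show ?case by (simp add: mult_ac)
  qed (use assms in simp)
  then show "psd_matrix N (\<lambda>i j. \<Sum>k<n. M i j * hinner (z i) (z j) ^ k)" for n
    by (intro psd_matrix_sum)
next
  fix i j assume "i < N" "j < N"
  then have "(\<lambda>k. hinner (z i) (z j) ^ k) sums (1 / (1 - hinner (z i) (z j)))"
    using z by (intro geometric_sums norm_hinner_less_one)
  from sums_mult[OF this, of "M i j"]
  show "(\<lambda>n. \<Sum>k<n. M i j * hinner (z i) (z j) ^ k) \<longlonglongrightarrow> M i j / (1 - hinner (z i) (z j))"
    by (simp add: sums_def)
qed

section \<open>Gram matrices of the Hermitian inner product\<close>

lemma hinner_add_left: "hinner (x + y) w = hinner x w + hinner y w"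
  by (simp add: hinner_def distrib_right sum.distrib)

lemma hinner_smult_left: "hinner (c *s x) w = c * hinner x w"
  by (simp add: hinner_def sum_distrib_left mult_ac)

lemma hinner_sum_left: "hinner (\<Sum>i\<in>I. f i) w = (\<Sum>i\<in>I. hinner (f i) w)"
  by (simp add: hinner_def sum_distrib_right) (rule sum.swap)

lemma hinner_scaleR_left: "hinner (r *\<^sub>R x) w = r *\<^sub>R hinner x w"
  by (simp add: hinner_def scaleR_sum_right)

lemma matrix_vector_mult_scaleR_complex:
  fixes A :: "complex ^ 'm ^ 'n"
  shows "A *v (r *\<^sub>R x) = r *\<^sub>R (A *v x)"
  by (rule linear_scale) simp

lemma norm_smult: "norm (c *s x) = norm c * norm x" for x :: "complex ^ 'm"
  by (simp add: norm_vec_def L2_set_right_distrib norm_mult)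

lemma scaleR_smult: "(r *\<^sub>R c) *s x = r *\<^sub>R (c *s x)" "c *s (r *\<^sub>R x) = r *\<^sub>R (c *s x)"
  for x :: "complex ^ 'm"
  by (simp_all add: vec_eq_iff)

lemma gram_form:
  "(\<Sum>i<N. \<Sum>j<N. cnj (c i) * hinner (x i) (x j) * c j) =
     of_real ((norm (\<Sum>i<N. cnj (c i) *s x i))\<^sup>2)"
proof -
  let ?v = "\<Sum>i<N. cnj (c i) *s x i"
  have right: "hinner y ?v = (\<Sum>j<N. hinner y (x j) * c j)" for y
    by (subst cnj_hinner[symmetric]) (simp add: hinner_sum_left hinner_smult_left cnj_hinner mult_ac)
  have "of_real ((norm ?v)\<^sup>2) = hinner ?v ?v"
    by (simp only: hinner_self)
  also have "\<dots> = (\<Sum>i<N. cnj (c i) * hinner (x i) ?v)"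
    by (simp only: hinner_sum_left hinner_smult_left)
  also have "\<dots> = (\<Sum>i<N. \<Sum>j<N. cnj (c i) * hinner (x i) (x j) * c j)"
    by (simp add: right sum_distrib_left mult_ac)
  finally show ?thesis ..
qed

section \<open>The multiplier of a self-map of the ball\<close>

text \<open>
  For \<open>norm z < norm t\<close> this is the hypothesis at \<open>z / t\<close>, multiplied by \<open>norm t\<close>. The boundary case
  follows by continuity along \<open>r *\<^sub>R z\<close> as \<open>r\<close> increases to \<open>1\<close>; the S-lemma needs it, since its
  hypothesis is about the closed cone.
\<close>
lemma homogenized_denominator_dominates:
  fixes A :: "complex ^ 'm ^ 'm"
  assumes d: "\<And>z. z \<in> unit_ball \<Longrightarrow> norm (A *v z + B) \<le> norm (hinner z C + D)"
    and le: "norm z \<le> norm t"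
  shows "norm (A *v z + t *s B) \<le> norm (hinner z C + t * D)"
proof (cases "t = 0")
  case True
  then show ?thesis using le by (simp add: hinner_def)
next
  case False
  have scaled: "norm (A *v (r *\<^sub>R z) + t *s B) \<le> norm (hinner (r *\<^sub>R z) C + t * D)"
    if r: "0 < r" "r < 1" for r :: real
  proof -
    let ?y = "(1 / t) *s (r *\<^sub>R z)"
    have t_y: "r *\<^sub>R z = t *s ?y" using False by (simp add: vec_eq_iff)
    have "norm t * norm ?y = norm (r *\<^sub>R z)"
      by (subst (2) t_y) (simp only: norm_smult)
    also have "\<dots> \<le> r * norm t"
      using r le by simp
    also have "\<dots> < norm t"
      using r False by simp
    finally have "?y \<in> unit_ball" using False by simp
    from d[OF this] have "norm t * norm (A *v ?y + B) \<le> norm t * norm (hinner ?y C + D)"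
      by (simp add: mult_left_mono)
    moreover have "A *v (r *\<^sub>R z) + t *s B = t *s (A *v ?y + B)"
      by (subst t_y) (simp add: vector_add_ldistrib vector_scalar_commute)
    moreover have "hinner (r *\<^sub>R z) C + t * D = t * (hinner ?y C + D)"
      by (subst t_y) (simp add: hinner_smult_left algebra_simps)
    ultimately show ?thesis by (simp only: norm_smult norm_mult)
  qed
  have "((\<lambda>r. norm (hinner (r *\<^sub>R z) C + t * D) - norm (A *v (r *\<^sub>R z) + t *s B)) \<longlongrightarrow>
      norm (hinner (1 *\<^sub>R z) C + t * D) - norm (A *v (1 *\<^sub>R z) + t *s B)) (at_left 1)"
    unfolding hinner_scaleR_left matrix_vector_mult_scaleR_complex by (intro tendsto_intros)
  moreover have "eventually (\<lambda>r::real. 0 < r \<and> r < 1) (at_left 1)"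
    using eventually_at_left_real[of 0 1] by (auto elim: eventually_mono)
  then have "eventually (\<lambda>r. 0 \<le> norm (hinner (r *\<^sub>R z) C + t * D) - norm (A *v (r *\<^sub>R z) + t *s B))
      (at_left 1)"
    by eventually_elim (use scaled in auto)
  ultimately show ?thesis
    using tendsto_lowerbound[where F = "at_left (1::real)"] by fastforce
qed

lemma bilinear_inner_diff:
  fixes f :: "'a::real_vector \<Rightarrow> 'b::real_inner" and g :: "'a \<Rightarrow> 'c::real_inner"
  assumes "linear f" "linear g"
  shows "bilinear (\<lambda>x y. inner (f x) (f y) - inner (g x) (g y))"
  unfolding bilinear_def
  by (auto intro!: linearI simp: linear_add[OF assms(1)] linear_add[OF assms(2)]
      linear_scale[OF assms(1)] linear_scale[OF assms(2)] algebra_simps)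

text \<open>
  The S-lemma is applied on \<open>\<complex>\<^sup>m \<times> \<complex>\<close> regarded as a real vector space, where the real parts of
  the Hermitian forms are symmetric bilinear and have the same diagonal values.
\<close>
lemma s_lemma_linear_fractional:
  fixes A :: "complex ^ 'm ^ 'm"
  assumes "\<And>z. z \<in> unit_ball \<Longrightarrow> norm (A *v z + B) \<le> norm (hinner z C + D)"
  obtains \<kappa> where "\<kappa> \<ge> 0"
    "\<And>z t. (norm (hinner z C + t * D))\<^sup>2 - (norm (A *v z + t *s B))\<^sup>2
        \<ge> \<kappa> * ((norm t)\<^sup>2 - (norm z)\<^sup>2)"
proof -
  define n where "n x = A *v fst x + snd x *s B" for x
  define d where "d x = hinner (fst x) C + snd x * D" for x
  have n: "linear n"
    unfolding n_def by (rule linearI)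
      (simp_all add: matrix_vector_right_distrib vector_sadd_rdistrib
        matrix_vector_mult_scaleR_complex scaleR_smult scaleR_right_distrib)
  have d: "linear d"
    unfolding d_def by (rule linearI)
      (simp_all add: hinner_add_left hinner_scaleR_left distrib_right scaleR_right_distrib)
  define F where "F x y = inner (d x) (d y) - inner (n x) (n y)" for x y
  define G where "G x y = inner (snd x) (snd y) - inner (fst x) (fst y)"
    for x y :: "(complex ^ 'm) \<times> complex"
  have "bilinear F" "bilinear G"
    unfolding F_def G_def
    by (intro bilinear_inner_diff n d bounded_linear.linear bounded_linear_fst bounded_linear_snd)+
  moreover have "F x x \<ge> 0" if "G x x \<ge> 0" for x
  proof -
    have "norm (fst x) \<le> norm (snd x)"
      using that by (simp add: G_def flip: power2_norm_eq_inner)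
    from homogenized_denominator_dominates[OF assms this] show ?thesis
      by (simp add: F_def n_def d_def flip: power2_norm_eq_inner)
  qed
  moreover have "G (0, 1) (0, 1) > 0" by (simp add: G_def)
  ultimately obtain \<kappa> where "\<kappa> \<ge> 0" and le: "\<And>x. F x x \<ge> \<kappa> * G x x"
    using s_lemma[of F G] by (metis F_def G_def inner_commute)
  then show thesis
    using that le[of "(_, _)"] by (auto simp: F_def G_def n_def d_def simp flip: power2_norm_eq_inner)
qed

section \<open>Linear fractional maps are Schur-Agler\<close>

lemma smult_left_bilinear: "bilinear (\<lambda>(c::complex) (x::complex ^ 'm). c *s x)"
  unfolding bilinear_def
  by (auto intro!: linearI simp: scaleR_smult vector_add_ldistrib vector_sadd_rdistrib)

text \<open>
  The product rule produces a real derivative; it is \<open>\<complex>\<close>-linear because numerator and denominator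
  are \<open>\<complex>\<close>-affine, and this is what turns it into a complex matrix.
\<close>
lemma holomorphic_linear_fractional:
  assumes "linear_fractional \<phi>"
  shows "holomorphic_map_on \<phi> unit_ball"
  unfolding holomorphic_map_on_def
proof
  obtain A B C D where nz: "\<And>z. z \<in> unit_ball \<Longrightarrow> hinner z C + D \<noteq> 0"
    and \<phi>: "\<And>z. z \<in> unit_ball \<Longrightarrow> \<phi> z = (1 / (hinner z C + D)) *s (A *v z + B)"
    using assms unfolding linear_fractional_def by blast
  fix z :: "complex ^ 'a" assume z: "z \<in> unit_ball"
  define J where "J h = (1 / (hinner z C + D)) *s (A *v h)
      + (- (inverse (hinner z C + D) * hinner h C * inverse (hinner z C + D))) *s (A *v z + B)" for h
  have "bounded_linear (\<lambda>z. hinner z C)" "bounded_linear (\<lambda>z. A *v z)"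
    unfolding linear_conv_bounded_linear[symmetric]
    by (auto intro!: linearI simp: hinner_add_left hinner_scaleR_left
        matrix_vector_mult_scaleR_complex matrix_vector_right_distrib)
  note lin = this[THEN bounded_linear_imp_has_derivative]
  have den: "((\<lambda>z. 1 / (hinner z C + D)) has_derivative
      (\<lambda>h. - (inverse (hinner z C + D) * hinner h C * inverse (hinner z C + D)))) (at z within unit_ball)"
    using Deriv.has_derivative_inverse[OF nz[OF z] has_derivative_add_const[OF lin(1)]]
    by (simp add: inverse_eq_divide)
  have "((\<lambda>z. (1 / (hinner z C + D)) *s (A *v z + B)) has_derivative J) (at z within unit_ball)"
    unfolding J_def
    using bounded_bilinear.FDERIV[OF smult_left_bilinear[unfolded bilinear_conv_bounded_bilinear]
      den has_derivative_add_const[OF lin(2)]] .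
  then have "(\<phi> has_derivative J) (at z within unit_ball)"
    by (rule has_derivative_transform[OF z \<phi>, rotated]) simp
  moreover have "Vector_Spaces.linear (*s) (*s) J"
    unfolding J_def
    by unfold_locales (simp_all add: hinner_add_left hinner_smult_left matrix_vector_right_distrib
        vector_scalar_commute vec_eq_iff algebra_simps)
  then have "J = (\<lambda>h. matrix J *v h)" by (simp add: matrix_works fun_eq_iff)
  ultimately show "\<exists>J. (\<phi> has_derivative (\<lambda>h. J *v h)) (at z within unit_ball)" by metis
qed

theorem theorem2p1:
  fixes \<phi> :: "complex ^ 'm \<Rightarrow> complex ^ 'm"
  assumes "linear_fractional \<phi>"
    and "\<phi> ` unit_ball \<subseteq> unit_ball"
  shows "\<phi> \<in> schur_agler_class"
proof -
  obtain A B C D where nz: "\<And>z. z \<in> unit_ball \<Longrightarrow> hinner z C + D \<noteq> 0"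
    and \<phi>: "\<And>z. z \<in> unit_ball \<Longrightarrow> \<phi> z = (1 / (hinner z C + D)) *s (A *v z + B)"
    using assms(1) unfolding linear_fractional_def by blast
  define d where "d z = hinner z C + D" for z
  define n where "n z = A *v z + B" for z
  have n_eq: "n z = d z *s \<phi> z" if "z \<in> unit_ball" for z
    using nz[OF that] \<phi>[OF that] by (simp add: n_def d_def)
  have "norm (n z) \<le> norm (d z)" if z: "z \<in> unit_ball" for z
  proof -
    have "norm (\<phi> z) < 1" using assms(2) z by (metis image_subset_iff mem_ball_0)
    then show ?thesis using n_eq[OF z] by (simp add: norm_smult mult_left_le)
  qed
  then obtain \<kappa> where \<kappa>: "\<kappa> \<ge> 0"
    and le: "\<And>z t. (norm (hinner z C + t * D))\<^sup>2 - (norm (A *v z + t *s B))\<^sup>2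
        \<ge> \<kappa> * ((norm t)\<^sup>2 - (norm z)\<^sup>2)"
    using s_lemma_linear_fractional[of A B C D] unfolding n_def d_def by blast
  have "psd_kernel_on unit_ball (schur_kernel \<phi>)"
    unfolding psd_kernel_on_def
  proof (intro allI impI)
    fix N and z :: "nat \<Rightarrow> complex ^ 'm"
    assume "\<forall>i<N. z i \<in> unit_ball"
    then have z: "\<And>i. i < N \<Longrightarrow> z i \<in> unit_ball" by blast
    define H where "H i j = d (z i) * cnj (d (z j)) - hinner (n (z i)) (n (z j))
        - of_real \<kappa> * (1 - hinner (z i) (z j))" for i j
    have "psd_matrix N H"
    proof (rule psd_matrixI)
      fix c :: "nat \<Rightarrow> complex"
      \<comment> \<open>The quadratic form of \<open>H\<close> at \<open>c\<close> is \<open>F - \<kappa> G\<close> at the combination \<open>(v, t)\<close> of the points \<open>(z i, 1)\<close>.\<close>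
      define v where "v = (\<Sum>i<N. cnj (c i) *s z i)"
      define t where "t = (\<Sum>i<N. cnj (c i))"
      have "(\<Sum>i<N. cnj (c i) * d (z i)) = hinner v C + t * D"
        by (simp add: d_def v_def t_def hinner_sum_left hinner_smult_left distrib_left sum.distrib
            sum_distrib_right)
      moreover have "(\<Sum>i<N. cnj (c i) *s n (z i)) = A *v v + t *s B"
        by (simp add: n_def v_def t_def linear_sum[OF matrix_vector_mul_linear]
            vector_scalar_commute vector_add_ldistrib sum.distrib vec.scale_sum_left)
      moreover have "(\<Sum>i<N. \<Sum>j<N. cnj (c i) * H i j * c j) =
          (\<Sum>i<N. \<Sum>j<N. cnj (c i) * (d (z i) * cnj (d (z j))) * c j)
          - (\<Sum>i<N. \<Sum>j<N. cnj (c i) * hinner (n (z i)) (n (z j)) * c j)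
          - of_real \<kappa> * ((\<Sum>i<N. \<Sum>j<N. cnj (c i) * (1 * cnj 1) * c j)
              - (\<Sum>i<N. \<Sum>j<N. cnj (c i) * hinner (z i) (z j) * c j))"
        by (simp add: H_def algebra_simps sum.distrib sum_subtractf sum_distrib_left)
      ultimately have "(\<Sum>i<N. \<Sum>j<N. cnj (c i) * H i j * c j) = of_real
          ((norm (hinner v C + t * D))\<^sup>2 - (norm (A *v v + t *s B))\<^sup>2
            - \<kappa> * ((norm t)\<^sup>2 - (norm v)\<^sup>2))"
        unfolding gram_form rank_one_form by (simp add: v_def t_def)
      then show "(\<Sum>i<N. \<Sum>j<N. cnj (c i) * H i j * c j) \<in> \<real>\<^sub>\<ge>\<^sub>0"
        using le[of t v] by (simp only: nonneg_Reals_of_real_iff)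
    qed (simp add: H_def cnj_hinner mult_ac)
    from psd_matrix_divide_one_minus_hinner[OF this z]
    have "psd_matrix N (\<lambda>i j. of_real \<kappa> + H i j / (1 - hinner (z i) (z j)))"
      by (intro psd_matrix_add psd_matrix_const \<kappa>)
    then have "psd_matrix N (\<lambda>i j. (1 / d (z i)) *
        (of_real \<kappa> + H i j / (1 - hinner (z i) (z j))) * cnj (1 / d (z j)))"
      by (rule psd_matrix_congruence)
    also have "psd_matrix N (\<lambda>i j. (1 / d (z i)) *
        (of_real \<kappa> + H i j / (1 - hinner (z i) (z j))) * cnj (1 / d (z j))) =
        psd_matrix N (\<lambda>i j. schur_kernel \<phi> (z i) (z j))"
    proof (rule psd_matrix_cong)
      fix i j assume ij: "i < N" "j < N"
      have "hinner (z i) (z j) \<noteq> 1"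
        using norm_hinner_less_one[OF z z, OF ij] by auto
      moreover have "d (z i) \<noteq> 0" "d (z j) \<noteq> 0" using nz z ij by (auto simp: d_def)
      moreover have "hinner (n (z i)) (n (z j)) = d (z i) * cnj (d (z j)) * hinner (\<phi> (z i)) (\<phi> (z j))"
        using ij z by (simp add: n_eq hinner_def sum_distrib_left mult_ac)
      ultimately show "(1 / d (z i)) * (of_real \<kappa> + H i j / (1 - hinner (z i) (z j))) * cnj (1 / d (z j))
          = schur_kernel \<phi> (z i) (z j)"
        by (simp add: H_def schur_kernel_def divide_simps) (simp add: algebra_simps)
    qed
    finally show "psd_matrix N (\<lambda>i j. schur_kernel \<phi> (z i) (z j))" .
  qed
  then show ?thesis
    using assms holomorphic_linear_fractional by (simp add: schur_agler_class_def)
qed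

end
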